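(* A comparability graph $G$ is uniquely quasi-transitively orientable if and only if $G$ admits only trivial quasi-transitive $2$-edge-colourings.
   Context: A comparability graph is a graph admitting a transitive orientation (equivalently, the comparability graph of a partial order). A quasi-transitive orientation of a graph $G$ is an orientation of its edges such that whenever $u\to v$ and $v\to w$ are arcs with $u\neq w$, the vertices $u$ and $w$ are adjacent in $G$ (i.e., there is no induced directed path of length $2$). $G$ is uniquely quasi-transitively orientable if it has exactly two quasi-transitive orientations. A quasi-transitive $2$-edge-colouring of $G$ is a map $c: E(G)\to\{R,B\}$ such that for all pairs of edges $xy, yz \in E(G)$ with $c(xy)\neq c(yz)$, we have $xz\in E(G)$; it is trivial if it is constant on $E(G)$.
   Formalization: The graph G is assumed to have at least one edge; for an edgeless graph the claim fails, since it has exactly one (empty) quasi-transitive orientation while its only 2-edge-colouring is vacuously trivial. *)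

theory Defs
  imports "HOL-Library.Ramsey"
begin

text \<open>A simple undirected graph is given by a vertex set \<open>V\<close> and a set \<open>E\<close> of two-element
  subsets of \<open>V\<close>; neither is assumed to be finite. Thus \<open>{u, v} \<in> E\<close> says that \<open>u\<close> and \<open>v\<close>
  are adjacent, and entails \<open>u \<noteq> v\<close>.\<close>

definition simple_graph :: "'a set \<Rightarrow> 'a set set \<Rightarrow> bool" where
  "simple_graph V E \<longleftrightarrow> E \<subseteq> nsets V 2"

definition orientation :: "'a set set \<Rightarrow> ('a \<times> 'a) set \<Rightarrow> bool" where
  "orientation E D \<longleftrightarrow>
     (\<forall>u v. (u, v) \<in> D \<longrightarrow> {u, v} \<in> E) \<and>
     (\<forall>u v. {u, v} \<in> E \<longrightarrow> ((u, v) \<in> D \<longleftrightarrow> (v, u) \<notin> D))"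

definition comparability_graph :: "'a set \<Rightarrow> 'a set set \<Rightarrow> bool" where
  "comparability_graph V E \<longleftrightarrow> simple_graph V E \<and> (\<exists>D. orientation E D \<and> trans D)"

definition quasi_transitive_orientation :: "'a set set \<Rightarrow> ('a \<times> 'a) set \<Rightarrow> bool" where
  "quasi_transitive_orientation E D \<longleftrightarrow>
     orientation E D \<and>
     (\<forall>u v w. (u, v) \<in> D \<and> (v, w) \<in> D \<and> u \<noteq> w \<longrightarrow> {u, w} \<in> E)"

definition uniquely_quasi_transitively_orientable :: "'a set set \<Rightarrow> bool" where
  "uniquely_quasi_transitively_orientable E \<longleftrightarrow>
     card {D. quasi_transitive_orientation E D} = 2"

datatype colour = Red | Blue

text \<open>Colourings are total functions, of which only the values on \<open>E\<close> matter.\<close>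

definition quasi_transitive_colouring :: "'a set set \<Rightarrow> ('a set \<Rightarrow> colour) \<Rightarrow> bool" where
  "quasi_transitive_colouring E c \<longleftrightarrow>
     (\<forall>x y z. {x, y} \<in> E \<and> {y, z} \<in> E \<and> c {x, y} \<noteq> c {y, z} \<longrightarrow> {x, z} \<in> E)"

definition trivial_colouring :: "'a set set \<Rightarrow> ('a set \<Rightarrow> colour) \<Rightarrow> bool" where
  "trivial_colouring E c \<longleftrightarrow> (\<exists>k. \<forall>e\<in>E. c e = k)"

end

theory Submission imports Defs begin

text \<open>Fix a quasi-transitive orientation \<open>D\<close>. An orientation amounts to a 2-edge-colouring that
  records which edges of \<open>D\<close> it keeps (Red) and which it reverses (Blue). If \<open>x\<close> and \<open>z\<close> are
  distinct non-adjacent neighbours of \<open>y\<close>, then \<open>D\<close> directs \<open>xy\<close> and \<open>yz\<close> both into \<open>y\<close> or both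
  out of \<open>y\<close>; another orientation does the same iff it keeps or reverses both edges. So
  quasi-transitive orientations correspond to quasi-transitive colourings, with \<open>D\<close> and its converse
  corresponding to the two constant ones.\<close>

definition reorient :: "('a \<times> 'a) set \<Rightarrow> ('a set \<Rightarrow> colour) \<Rightarrow> ('a \<times> 'a) set" where
  "reorient D c = {(u, v). if c {u, v} = Red then (u, v) \<in> D else (v, u) \<in> D}"

text \<open>Edges are unordered, so the existential tries both orderings of the endpoints. A set
  carrying no common arc, such as a non-edge when \<open>D\<close> is an orientation, defaults to
  \<open>Blue\<close>.\<close>

definition agreement :: "('a \<times> 'a) set \<Rightarrow> ('a \<times> 'a) set \<Rightarrow> 'a set \<Rightarrow> colour" where
  "agreement D D' e = (if \<exists>u v. e = {u, v} \<and> (u, v) \<in> D \<inter> D' then Red else Blue)"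

lemma mem_reorient:
  "(u, v) \<in> reorient D c \<longleftrightarrow> (if c {u, v} = Red then (u, v) \<in> D else (v, u) \<in> D)"
  by (simp add: reorient_def)

lemma orientation_edge: "orientation E D \<Longrightarrow> (u, v) \<in> D \<Longrightarrow> {u, v} \<in> E"
  by (simp add: orientation_def)

lemma orientation_flip: "orientation E D \<Longrightarrow> {u, v} \<in> E \<Longrightarrow> (v, u) \<in> D \<longleftrightarrow> (u, v) \<notin> D"
  by (simp add: orientation_def)

lemma quasi_transitive_imp_orientation: "quasi_transitive_orientation E D \<Longrightarrow> orientation E D"
  by (simp add: quasi_transitive_orientation_def)

lemma trans_imp_quasi_transitive:
  assumes "orientation E D" "trans D"
  shows "quasi_transitive_orientation E D"
  using assms unfolding quasi_transitive_orientation_def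
  by (meson orientation_edge transD)

lemma orientation_reorient:
  assumes "orientation E D"
  shows "orientation E (reorient D c)"
proof -
  have "{u, v} \<in> E" if "(u, v) \<in> reorient D c" for u v
    using that orientation_edge[OF assms, of u v] orientation_edge[OF assms, of v u]
    by (auto simp: mem_reorient insert_commute split: if_splits)
  moreover have "(u, v) \<in> reorient D c \<longleftrightarrow> (v, u) \<notin> reorient D c" if "{u, v} \<in> E" for u v
    using orientation_flip[OF assms that] by (simp add: mem_reorient insert_commute)
  ultimately show ?thesis
    unfolding orientation_def by blast
qed

text \<open>Each orientation contains exactly one of \<open>(u, v)\<close> and
  \<open>(v, u)\<close>. Hence if both omit \<open>(u, v)\<close>, the common arc witnessing
  \<open>Red\<close> is \<open>(v, u)\<close>.\<close>

lemma agreement_edge: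
  assumes "orientation E D" "orientation E D'" "{u, v} \<in> E"
  shows "agreement D D' {u, v} = Red \<longleftrightarrow> ((u, v) \<in> D \<longleftrightarrow> (u, v) \<in> D')"
  using orientation_flip[OF assms(1,3)] orientation_flip[OF assms(2,3)]
  by (auto simp: agreement_def doubleton_eq_iff)

text \<open>Surjectivity of \<open>reorient D\<close> onto the orientations of \<open>E\<close>: it
  lets a quantifier over orientations be traded for one over colourings.\<close>

lemma reorient_agreement:
  assumes D: "orientation E D" and D': "orientation E D'"
  shows "reorient D (agreement D D') = D'"
proof -
  have "(u, v) \<in> reorient D (agreement D D') \<longleftrightarrow> (u, v) \<in> D'" for u v
  proof (cases "{u, v} \<in> E")
    case True
    then show ?thesis
      using orientation_flip[OF D True] by (auto simp: mem_reorient agreement_edge[OF D D' True])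
  next
    \<comment> \<open>Both sides are orientations, so neither has an arc off
      \<open>E\<close>.\<close>
    case False
    then show ?thesis
      by (metis D' assms(1) orientation_edge orientation_reorient)
  qed
  then show ?thesis by auto
qed

text \<open>A directed path through the middle vertex \<open>y\<close>, in either direction, arises
  exactly when one edge enters \<open>y\<close> and the other leaves it. Phrased as an equivalence,
  the condition survives reversing both edges and breaks on reversing one.\<close>

lemma quasi_transitive_orientation_iff:
  assumes "orientation E D"
  shows "quasi_transitive_orientation E D \<longleftrightarrow>
    (\<forall>x y z. {x, y} \<in> E \<and> {y, z} \<in> E \<and> x \<noteq> z \<and> {x, z} \<notin> E \<longrightarrow>
      ((x, y) \<in> D \<longleftrightarrow> (z, y) \<in> D))"
    (is "_ \<longleftrightarrow> ?R")
proof
  assume qt: "quasi_transitive_orientation E D"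
  show ?R
  proof (intro allI impI)
    fix x y z
    assume *: "{x, y} \<in> E \<and> {y, z} \<in> E \<and> x \<noteq> z \<and> {x, z} \<notin> E"
    then have "\<not> ((x, y) \<in> D \<and> (y, z) \<in> D)" "\<not> ((z, y) \<in> D \<and> (y, x) \<in> D)"
      using qt unfolding quasi_transitive_orientation_def by (blast, metis insert_commute)
    with * show "(x, y) \<in> D \<longleftrightarrow> (z, y) \<in> D"
      using orientation_flip[OF assms, of x y] orientation_flip[OF assms, of y z] by blast
  qed
next
  assume R: ?R
  have "{u, w} \<in> E" if "(u, v) \<in> D" "(v, w) \<in> D" "u \<noteq> w" for u v w
  proof (rule ccontr)
    assume "{u, w} \<notin> E"
    moreover have "{u, v} \<in> E" "{v, w} \<in> E"
      using that orientation_edge[OF assms] by blast+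
    ultimately show False
      using R that orientation_flip[OF assms, of v w] by blast
  qed
  then show "quasi_transitive_orientation E D"
    unfolding quasi_transitive_orientation_def using assms by blast
qed

lemma quasi_transitive_reorient_iff:
  assumes qt: "quasi_transitive_orientation E D"
  shows "quasi_transitive_orientation E (reorient D c) \<longleftrightarrow> quasi_transitive_colouring E c"
proof -
  have D: "orientation E D"
    using qt by (rule quasi_transitive_imp_orientation)
  have same: "((x, y) \<in> reorient D c \<longleftrightarrow> (z, y) \<in> reorient D c) \<longleftrightarrow> c {x, y} = c {y, z}"
    if "{x, y} \<in> E" "{y, z} \<in> E" "x \<noteq> z" "{x, z} \<notin> E" for x y z
  proof -
    have "(x, y) \<in> D \<longleftrightarrow> (z, y) \<in> D"
      using qt that unfolding quasi_transitive_orientation_iff[OF D] by blast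
    moreover have "(y, x) \<in> D \<longleftrightarrow> (x, y) \<notin> D" "(z, y) \<in> D \<longleftrightarrow> (y, z) \<notin> D"
      using that orientation_flip[OF D] by blast+
    ultimately show ?thesis
      by (cases "c {x, y}"; cases "c {y, z}") (auto simp: mem_reorient insert_commute)
  qed
  \<comment> \<open>This is the contrapositive of the definition. The case \<open>x = z\<close>
    cannot violate it, because \<open>{x, y}\<close> and \<open>{y, z}\<close> are then the same
    edge and share a colour.\<close>
  have "quasi_transitive_colouring E c \<longleftrightarrow>
    (\<forall>x y z. {x, y} \<in> E \<and> {y, z} \<in> E \<and> x \<noteq> z \<and> {x, z} \<notin> E \<longrightarrow> c {x, y} = c {y, z})"
    unfolding quasi_transitive_colouring_def using insert_commute[of _ _ "{}"] by metis
  then show ?thesis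
    unfolding quasi_transitive_orientation_iff[OF orientation_reorient[OF D]]
    using same by blast
qed

lemma reorient_const_Red:
  assumes "\<And>e. e \<in> E \<Longrightarrow> c e = Red" "orientation E D"
  shows "reorient D c = D"
proof -
  have "(u, v) \<in> reorient D c \<longleftrightarrow> (u, v) \<in> D" for u v
    using assms(1)[of "{u, v}"] orientation_edge[OF assms(2), of u v]
      orientation_edge[OF assms(2), of v u]
    by (auto simp: mem_reorient insert_commute)
  then show ?thesis by auto
qed

lemma reorient_const_Blue:
  assumes "\<And>e. e \<in> E \<Longrightarrow> c e = Blue" "orientation E D"
  shows "reorient D c = D\<inverse>"
proof -
  have "(u, v) \<in> reorient D c \<longleftrightarrow> (v, u) \<in> D" for u v
    using assms(1)[of "{u, v}"] orientation_edge[OF assms(2), of u v]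
      orientation_edge[OF assms(2), of v u]
    by (auto simp: mem_reorient insert_commute)
  then show ?thesis by auto
qed

lemma simple_graph_edgeE:
  assumes "simple_graph V E" "e \<in> E"
  obtains u v where "e = {u, v}"
  using assms unfolding simple_graph_def nsets_def by (auto simp: card_2_iff)

text \<open>The colour of an edge can be read off from whether its arc was kept or reversed.
  Simplicity of the graph supplies the two endpoints of each edge on which to compare arcs.\<close>

lemma trivial_colouring_iff_reorient:
  assumes G: "simple_graph V E" and D: "orientation E D"
  shows "trivial_colouring E c \<longleftrightarrow> reorient D c \<in> {D, D\<inverse>}"
proof
  assume "trivial_colouring E c"
  then obtain k where k: "\<And>e. e \<in> E \<Longrightarrow> c e = k"
    unfolding trivial_colouring_def by blast
  then show "reorient D c \<in> {D, D\<inverse>}"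
    using reorient_const_Red[OF _ D] reorient_const_Blue[OF _ D] by (cases k) auto
next
  assume R: "reorient D c \<in> {D, D\<inverse>}"
  have Red: "c e = Red" if "reorient D c = D" "e \<in> E" for e
  proof -
    obtain u v where e: "e = {u, v}" using G \<open>e \<in> E\<close> by (rule simple_graph_edgeE)
    have "(u, v) \<in> reorient D c \<longleftrightarrow> (u, v) \<in> D" using that(1) by simp
    with e that(2) orientation_flip[OF D, of u v] show ?thesis
      by (auto simp: mem_reorient split: if_splits)
  qed
  have Blue: "c e = Blue" if "reorient D c = D\<inverse>" "e \<in> E" for e
  proof -
    obtain u v where e: "e = {u, v}" using G \<open>e \<in> E\<close> by (rule simple_graph_edgeE)
    have "(u, v) \<in> reorient D c \<longleftrightarrow> (v, u) \<in> D" using that(1) by simp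
    with e that(2) orientation_flip[OF D, of u v] show ?thesis
      by (cases "c {u, v}") (auto simp: mem_reorient split: if_splits)
  qed
  show "trivial_colouring E c"
    using R Red Blue unfolding trivial_colouring_def by blast
qed

text \<open>The constant \<open>Blue\<close> colouring is vacuously quasi-transitive, and it
  reverses every arc of \<open>D\<close>.\<close>

lemma quasi_transitive_converse:
  assumes "quasi_transitive_orientation E D"
  shows "quasi_transitive_orientation E (D\<inverse>)"
  using quasi_transitive_reorient_iff[OF assms, of "\<lambda>_. Blue"]
    reorient_const_Blue[of E "\<lambda>_. Blue", OF _ quasi_transitive_imp_orientation[OF assms]]
  by (simp add: quasi_transitive_colouring_def)

text \<open>An edge contributes just one of its two arcs to \<open>D\<close> and the other to the
  converse. With no edges, the empty relation would be the sole orientation and its own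
  converse.\<close>

lemma orientation_neq_converse:
  assumes "simple_graph V E" "E \<noteq> {}" "orientation E D"
  shows "D \<noteq> D\<inverse>"
proof -
  obtain e where "e \<in> E" using assms(2) by blast
  with assms(1) obtain u v where "{u, v} \<in> E" by (metis simple_graph_edgeE)
  then show ?thesis
    using orientation_flip[OF assms(3)] by blast
qed

lemma uniquely_quasi_transitively_orientable_iff:
  assumes "simple_graph V E" "E \<noteq> {}" "quasi_transitive_orientation E D"
  shows "uniquely_quasi_transitively_orientable E \<longleftrightarrow>
    (\<forall>D'. quasi_transitive_orientation E D' \<longrightarrow> D' \<in> {D, D\<inverse>})"
proof -
  let ?Q = "{D'. quasi_transitive_orientation E D'}"
  have sub: "{D, D\<inverse>} \<subseteq> ?Q"
    using assms(3) quasi_transitive_converse by blast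
  have card: "card {D, D\<inverse>} = 2"
    using orientation_neq_converse[OF assms(1,2) quasi_transitive_imp_orientation[OF assms(3)]]
    by simp
  have "card ?Q = 2 \<longleftrightarrow> ?Q = {D, D\<inverse>}"
  proof
    assume "card ?Q = 2"
    \<comment> \<open>\<open>card\<close> is 0 on infinite sets, so the value 2 forces finiteness; a
      two-element subset then exhausts the set.\<close>
    then have "finite ?Q" by (metis card.infinite zero_neq_numeral)
    then show "?Q = {D, D\<inverse>}"
      using card_subset_eq[OF _ sub] card \<open>card ?Q = 2\<close> by simp
  qed (use card in simp)
  then show ?thesis
    using sub unfolding uniquely_quasi_transitively_orientable_def by blast
qed

theorem theorem34:
  fixes V :: "'a set" and E :: "'a set set"
  assumes "comparability_graph V E"
    and "E \<noteq> {}"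
  shows "uniquely_quasi_transitively_orientable E \<longleftrightarrow>
    (\<forall>c. quasi_transitive_colouring E c \<longrightarrow> trivial_colouring E c)"
proof -
  from assms(1) obtain D where G: "simple_graph V E" and D: "orientation E D" and "trans D"
    unfolding comparability_graph_def by blast
  then have qt: "quasi_transitive_orientation E D"
    by (simp add: trans_imp_quasi_transitive)
  have "uniquely_quasi_transitively_orientable E \<longleftrightarrow>
      (\<forall>D'. quasi_transitive_orientation E D' \<longrightarrow> D' \<in> {D, D\<inverse>})"
    by (rule uniquely_quasi_transitively_orientable_iff[OF G assms(2) qt])
  \<comment> \<open>From right to left, a given \<open>D'\<close> is reached by taking
    \<open>c\<close> to be \<open>agreement D D'\<close>.\<close>
  also have "\<dots> \<longleftrightarrow> (\<forall>c. quasi_transitive_orientation E (reorient D c) \<longrightarrow>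
      reorient D c \<in> {D, D\<inverse>})"
    by (metis (no_types) reorient_agreement[OF D] quasi_transitive_imp_orientation)
  finally show ?thesis
    by (simp only: quasi_transitive_reorient_iff[OF qt] trivial_colouring_iff_reorient[OF G D])
qed

end
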